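(* There is an absolute constant $c>0$ such that the following holds. Let $f:\mathbb{R}^n\to\mathbb{R}$ be $\mathbf M$-smooth, $\mathbf M\succ0$, and $\mu$-strongly convex, $\mu>0$, with minimizer $x^*$. Let the sampling be $S=\{i\}$ with probability $p_i=\sqrt{\mathbf M_{ii}}/\sum_j\sqrt{\mathbf M_{jj}}$, $i\in\{1,\dots,n\}$. Then there exist parameters $\alpha,\beta>0$, $\tau\in(0,1)$ and a Lyapunov function $\Upsilon^k$ for the accelerated method ASEGA such that $f(y^k)-f(x^* )\le\Upsilon^k$ and, for all $k\ge0$, $$\mathbb{E}[\Upsilon^k]\le(1-\tau)^k\,\Upsilon^0,\qquad \tau\ge c\,\frac{\sqrt\mu}{\sum_i\sqrt{\mathbf M_{ii}}}.$$
   Context: $\nabla f$ is the usual gradient; $\|x\|_{\mathbf W}^2=x^\top\mathbf Wx$. $f$ is $\mathbf M$-smooth if it is differentiable and $f(x)\le f(y)+\langle\nabla f(y),x-y\rangle+\frac12\|x-y\|_{\mathbf M}^2$ for all $x,y$; $\mu$-strongly convex if $f(x)\ge f(y)+\langle\nabla f(y),x-y\rangle+\frac\mu2\|x-y\|_2^2$ for all $x,y$. $\hat{\mathbf P}=\mathrm{Diag}(p)$. ASEGA with parameters $\alpha,\beta,\tau,\mu$: start from $y^0=z^0\in\mathbb{R}^n$ and $h^0\in\mathbb{R}^n$ (arbitrary); for $k=0,1,2,\dots$ set $x^{k+1}=(1-\tau)y^k+\tau z^k$, draw $i$ independently of the past with probabilities $p_i$, and set $g^k=h^k+\frac1{p_i}e_i^\top(\nabla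 f(x^{k+1})-h^k)e_i$, $\;h^{k+1}=h^k+e_i^\top(\nabla f(x^{k+1})-h^k)e_i$, $y^{k+1}=x^{k+1}-\alpha\hat{\mathbf P}^{-1}g^k$, $\;z^{k+1}=\frac1{1+\beta\mu}\left(z^k+\beta\mu x^{k+1}-\beta g^k\right)$. A Lyapunov function here means a quantity of the form $\Upsilon^k=a\,(f(y^k)-f(x^* ))+b\,\|z^k-x^*\|_2^2+d\,\|h^k\|_{\hat{\mathbf P}^{-2}}^2$ with positive constants $a,b,d$ not depending on $k$ or on the starting point. *)

theory Defs
  imports "HOL-Probability.Probability_Mass_Function" "Jordan_Normal_Form.Matrix"
begin

no_notation inner (infix "\<bullet>" 70)
no_notation vec_nth (infixl "$" 90)

(* Points of R^n are real vectors in carrier_vec n, so that the dimension n is an ordinary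
   natural number and can be quantified after an absolute constant. Coordinates are
   0, ..., n-1. A function f on R^n is only ever evaluated on carrier_vec n. *)

type_synonym rvec = "real Matrix.vec"

definition norm2 :: "rvec \<Rightarrow> real" where
  "norm2 v = sqrt (v \<bullet> v)"

definition wnorm_sq :: "real mat \<Rightarrow> rvec \<Rightarrow> real" where
  "wnorm_sq W v = v \<bullet> (W *\<^sub>v v)"

definition pos_def_mat :: "nat \<Rightarrow> real mat \<Rightarrow> bool" where
  "pos_def_mat n M \<longleftrightarrow> M \<in> carrier_mat n n \<and> transpose_mat M = M \<and>
     (\<forall>v\<in>carrier_vec n. v \<noteq> 0\<^sub>v n \<longrightarrow> v \<bullet> (M *\<^sub>v v) > 0)"

(* Frechet differentiability of f at x, with derivative h \<mapsto> <g, h>. The type of vectors carries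
   no topology, hence the explicit epsilon and delta. *)
definition has_gradient :: "nat \<Rightarrow> (rvec \<Rightarrow> real) \<Rightarrow> rvec \<Rightarrow> rvec \<Rightarrow> bool" where
  "has_gradient n f g x \<longleftrightarrow> g \<in> carrier_vec n \<and>
     (\<forall>\<epsilon>>0. \<exists>\<delta>>0. \<forall>h\<in>carrier_vec n. norm2 h < \<delta> \<longrightarrow>
        \<bar>f (x + h) - f x - g \<bullet> h\<bar> \<le> \<epsilon> * norm2 h)"

definition grad :: "nat \<Rightarrow> (rvec \<Rightarrow> real) \<Rightarrow> rvec \<Rightarrow> rvec" where
  "grad n f x = (THE g. has_gradient n f g x)"

definition M_smooth :: "nat \<Rightarrow> real mat \<Rightarrow> (rvec \<Rightarrow> real) \<Rightarrow> bool" where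
  "M_smooth n M f \<longleftrightarrow>
     (\<forall>x\<in>carrier_vec n. \<exists>g. has_gradient n f g x) \<and>
     (\<forall>x\<in>carrier_vec n. \<forall>y\<in>carrier_vec n.
        f x \<le> f y + grad n f y \<bullet> (x - y) + 1/2 * wnorm_sq M (x - y))"

definition strongly_convex :: "nat \<Rightarrow> real \<Rightarrow> (rvec \<Rightarrow> real) \<Rightarrow> bool" where
  "strongly_convex n \<mu> f \<longleftrightarrow>
     (\<forall>x\<in>carrier_vec n. \<forall>y\<in>carrier_vec n.
        f x \<ge> f y + grad n f y \<bullet> (x - y) + \<mu>/2 * (norm2 (x - y))\<^sup>2)"

definition is_minimizer :: "nat \<Rightarrow> (rvec \<Rightarrow> real) \<Rightarrow> rvec \<Rightarrow> bool" where
  "is_minimizer n f xs \<longleftrightarrow> xs \<in> carrier_vec n \<and> (\<forall>x\<in>carrier_vec n. f xs \<le> f x)"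

(* The integer power Diag(p)^s of a diagonal matrix with positive entries p. *)
definition diag_powi :: "nat \<Rightarrow> (nat \<Rightarrow> real) \<Rightarrow> int \<Rightarrow> real mat" where
  "diag_powi n p s = mat_diag n (\<lambda>i. p i powi s)"

definition sqrt_diag_sum :: "nat \<Rightarrow> real mat \<Rightarrow> real" where
  "sqrt_diag_sum n M = (\<Sum>j<n. sqrt (M $$ (j, j)))"

definition sqrt_diag_sampling :: "nat \<Rightarrow> real mat \<Rightarrow> nat pmf" where
  "sqrt_diag_sampling n M =
     embed_pmf (\<lambda>i. if i < n then sqrt (M $$ (i, i)) / sqrt_diag_sum n M else 0)"

(* The state (y^k, z^k, h^k). *)
type_synonym asega_state = "rvec \<times> rvec \<times> rvec"

(* One iteration, with coordinate i drawn; p i is the probability of drawing i. *)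
definition asega_update ::
  "nat \<Rightarrow> (rvec \<Rightarrow> real) \<Rightarrow> (nat \<Rightarrow> real) \<Rightarrow> real \<Rightarrow> real \<Rightarrow> real \<Rightarrow> real \<Rightarrow> nat \<Rightarrow>
    asega_state \<Rightarrow> asega_state" where
  "asega_update n f p \<alpha> \<beta> \<tau> \<mu> i = (\<lambda>(y, z, h).
     let x = (1 - \<tau>) \<cdot>\<^sub>v y + \<tau> \<cdot>\<^sub>v z;
         \<delta> = unit_vec n i \<bullet> (grad n f x - h);
         g = h + (1 / p i * \<delta>) \<cdot>\<^sub>v unit_vec n i;
         h' = h + \<delta> \<cdot>\<^sub>v unit_vec n i;
         y' = x - \<alpha> \<cdot>\<^sub>v (diag_powi n p (-1) *\<^sub>v g);
         z' = (1 / (1 + \<beta> * \<mu>)) \<cdot>\<^sub>v (z + (\<beta> * \<mu>) \<cdot>\<^sub>v x - \<beta> \<cdot>\<^sub>v g)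
     in (y', z', h'))"

(* The law of (y^k, z^k, h^k) when y^0 = z^0 and the index is drawn from P in every iteration,
   independently of the past. *)
primrec asega ::
  "nat \<Rightarrow> (rvec \<Rightarrow> real) \<Rightarrow> nat pmf \<Rightarrow> real \<Rightarrow> real \<Rightarrow> real \<Rightarrow> real \<Rightarrow> rvec \<Rightarrow> rvec \<Rightarrow> nat \<Rightarrow>
    asega_state pmf" where
  "asega n f P \<alpha> \<beta> \<tau> \<mu> y0 h0 0 = return_pmf (y0, y0, h0)"
| "asega n f P \<alpha> \<beta> \<tau> \<mu> y0 h0 (Suc k) =
     bind_pmf (asega n f P \<alpha> \<beta> \<tau> \<mu> y0 h0 k)
       (\<lambda>s. map_pmf (\<lambda>i. asega_update n f (pmf P) \<alpha> \<beta> \<tau> \<mu> i s) P)"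

definition lyapunov ::
  "nat \<Rightarrow> (rvec \<Rightarrow> real) \<Rightarrow> (nat \<Rightarrow> real) \<Rightarrow> rvec \<Rightarrow> real \<Rightarrow> real \<Rightarrow> real \<Rightarrow>
    asega_state \<Rightarrow> real" where
  "lyapunov n f p xs a b d = (\<lambda>(y, z, h).
     a * (f y - f xs) + b * (norm2 (z - xs))\<^sup>2 + d * wnorm_sq (diag_powi n p (-2)) h)"


lemma norm2_smult: "v \<in> carrier_vec n \<Longrightarrow> norm2 (t \<cdot>\<^sub>v v) = \<bar>t\<bar> * norm2 v"
  by (simp add: norm2_def real_sqrt_mult flip: mult.assoc)

lemma scalar_prod_self_pos:
  assumes "v \<in> carrier_vec n" "v \<noteq> 0\<^sub>v n"
  shows "(v :: rvec) \<bullet> v > 0"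
proof -
  obtain i where i: "i < n" "v $ i \<noteq> 0"
    using assms by (metis carrier_vecD eq_vecI index_zero_vec)
  have "(\<Sum>i<n. v $ i * v $ i) > 0"
    by (rule sum_pos2[of _ i]) (use i in \<open>auto simp: not_sum_squares_lt_zero zero_less_mult_iff\<close>)
  then show ?thesis
    using assms by (simp add: scalar_prod_def atLeast0LessThan)
qed

lemma has_gradient_unique:
  assumes g: "has_gradient n f g x" and g': "has_gradient n f g' x"
  shows "g = g'"
proof (rule ccontr)
  assume ne: "g \<noteq> g'"
  have c: "g \<in> carrier_vec n" "g' \<in> carrier_vec n"
    using g g' by (auto simp: has_gradient_def)
  define u where "u = g - g'"
  have u: "u \<in> carrier_vec n" using c by (simp add: u_def)
  have "u \<noteq> 0\<^sub>v n"
  proof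
    assume "u = 0\<^sub>v n"
    then have "u $ i = 0" if "i < n" for i using that by simp
    then have "g = g'" using c by (intro eq_vecI) (auto simp: u_def)
    with ne show False by simp
  qed
  then have uu: "u \<bullet> u > 0" using scalar_prod_self_pos u by blast
  then have nu: "norm2 u > 0" by (simp add: norm2_def)
  have nu2: "u \<bullet> u = norm2 u * norm2 u" using uu by (simp add: norm2_def)
  define \<epsilon> where "\<epsilon> = norm2 u / 4"
  have e: "\<epsilon> > 0" using nu by (simp add: \<epsilon>_def)
  obtain d1 where d1: "d1 > 0" "\<And>h. h \<in> carrier_vec n \<Longrightarrow> norm2 h < d1 \<Longrightarrow>
      \<bar>f (x + h) - f x - g \<bullet> h\<bar> \<le> \<epsilon> * norm2 h"
    using g e unfolding has_gradient_def by blast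
  obtain d2 where d2: "d2 > 0" "\<And>h. h \<in> carrier_vec n \<Longrightarrow> norm2 h < d2 \<Longrightarrow>
      \<bar>f (x + h) - f x - g' \<bullet> h\<bar> \<le> \<epsilon> * norm2 h"
    using g' e unfolding has_gradient_def by blast
  define t where "t = min d1 d2 / (2 * norm2 u)"
  define h where "h = t \<cdot>\<^sub>v u"
  have t: "t > 0" using d1(1) d2(1) nu by (simp add: t_def)
  have h: "h \<in> carrier_vec n" using u by (simp add: h_def)
  have nh: "norm2 h = t * norm2 u" using norm2_smult[OF u] t by (simp add: h_def)
  have "norm2 h = min d1 d2 / 2" using nu by (simp add: nh t_def)
  then have small: "norm2 h < d1" "norm2 h < d2" using d1(1) d2(1) by linarith+
  have "\<bar>g \<bullet> h - g' \<bullet> h\<bar> \<le> 2 * (\<epsilon> * norm2 h)"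
    using d1(2)[OF h small(1)] d2(2)[OF h small(2)] by linarith
  moreover have "g \<bullet> h - g' \<bullet> h = u \<bullet> h"
    using minus_scalar_prod_distrib[OF c h] by (simp add: u_def)
  moreover have "u \<bullet> h = t * (u \<bullet> u)" using u by (simp add: h_def)
  ultimately have "t * (norm2 u * norm2 u) \<le> 2 * (norm2 u / 4 * (t * norm2 u))"
    by (simp add: nu2 nh \<epsilon>_def)
  moreover have "t * (norm2 u * norm2 u) > 0" using t nu by simp
  ultimately show False by (simp add: field_simps)
qed

lemma grad_eqI: "has_gradient n f g x \<Longrightarrow> grad n f x = g"
  unfolding grad_def by (blast intro: has_gradient_unique)

lemma pos_def_mat_diag_pos:
  assumes "pos_def_mat n M" "i < n"
  shows "M $$ (i, i) > 0"
proof -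
  have M: "M \<in> carrier_mat n n" using assms by (simp add: pos_def_mat_def)
  have "unit_vec n i \<noteq> (0\<^sub>v n :: rvec)"
    using assms(2) by (metis index_unit_vec(1) index_zero_vec(1) zero_neq_one)
  then have "unit_vec n i \<bullet> (M *\<^sub>v unit_vec n i) > 0"
    using assms by (auto simp: pos_def_mat_def)
  moreover have "unit_vec n i \<bullet> (M *\<^sub>v unit_vec n i) = M $$ (i, i)"
    using M assms(2) by (simp add: scalar_prod_left_unit[of _ n])
  ultimately show ?thesis by simp
qed

lemma pmf_sqrt_diag_sampling:
  assumes "pos_def_mat n M" "n \<ge> 1"
  shows "pmf (sqrt_diag_sampling n M) i =
    (if i < n then sqrt (M $$ (i, i)) / sqrt_diag_sum n M else 0)"
proof -
  have pos: "sqrt_diag_sum n M > 0"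
    unfolding sqrt_diag_sum_def
    by (rule sum_pos) (use assms pos_def_mat_diag_pos in \<open>auto simp: lessThan_empty_iff\<close>)
  let ?q = "\<lambda>i. if i < n then sqrt (M $$ (i, i)) / sqrt_diag_sum n M else 0"
  have nonneg: "?q i \<ge> 0" for i
    using pos pos_def_mat_diag_pos[OF assms(1), of i] by (simp add: less_imp_le)
  have "(\<integral>\<^sup>+ i. ennreal (?q i) \<partial>count_space UNIV) = (\<Sum>i<n. ennreal (?q i))"
    by (rule nn_integral_count_space'[of "{..<n}"]) auto
  also have "\<dots> = ennreal (\<Sum>i<n. ?q i)"
    by (rule sum_ennreal) (rule nonneg)
  also have "(\<Sum>i<n. ?q i) = sqrt_diag_sum n M / sqrt_diag_sum n M"
    by (subst (2) sqrt_diag_sum_def) (simp add: sum_divide_distrib)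
  finally have "(\<integral>\<^sup>+ i. ennreal (?q i) \<partial>count_space UNIV) = 1" using pos by simp
  then show ?thesis
    unfolding sqrt_diag_sampling_def by (subst pmf_embed_pmf[OF nonneg]) simp_all
qed

end

theory Submission
  imports Defs
begin

text \<open>
  One step of ASEGA contracts the Lyapunov function
  \<open>f y - f xs + b * (norm2 (z - xs))\<^sup>2 + d * wnorm_sq (diag_powi n p (-2)) h\<close> in conditional
  expectation; the statement about \<open>k\<close> steps follows by induction along the Markov chain of the
  states. Write \<open>S\<close> for the sum of the \<open>sqrt (M $$ (j, j))\<close>, \<open>v\<close> for the gradient at \<open>x\<close>, and \<open>dual_sq\<close>
  for the squared norm with weights \<open>1 / p i\<close>.

  The step has two sources of noise: the random coordinate and the stale gradient memory \<open>h\<close>. Both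
  are controlled by one second moment bound for the estimator \<open>g\<close>, in an arbitrary positive
  semidefinite quadratic form (\<open>mean_estimator_wnorm_sq\<close>). Because \<open>M $$ (i, i) = (p i)\<^sup>2 * S\<^sup>2\<close> for this
  sampling, the bound gives \<open>2 * S\<^sup>2 * (dual_sq v + dual_sq h)\<close> for the preconditioned estimator in the
  form of \<open>M\<close>, and \<open>2 * (dual_sq v + dual_sq h)\<close> for \<open>g\<close> itself in the Euclidean norm. So both the
  gradient step (\<open>mean_gradient_step\<close>) and the mirror step (\<open>mean_mirror_step\<close>) pay the same two
  quantities. The gradient step gains \<open>\<alpha> * dual_sq v\<close>, and refreshing the memory
  (\<open>mean_gradient_memory\<close>) trades \<open>dual_sq h\<close> for \<open>dual_sq v\<close>, so the \<open>dual_sq h\<close> terms can be paid by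
  the memory and the \<open>dual_sq v\<close> terms by the gradient step.

  The function values and distances are coupled as in the usual analysis of accelerated methods:
  strong convexity is applied from \<open>x\<close> towards \<open>xs\<close> and towards \<open>y\<close>, and the choice
  \<open>\<beta> * \<mu> = \<tau> / (1 - \<tau>)\<close> makes the contraction factor \<open>1 / (1 + \<beta> * \<mu>)\<close> of the mirror step equal to
  \<open>1 - \<tau>\<close>. The weight \<open>b = \<mu> / (2 * (1 - \<tau>))\<close> scales the mirror step so that its term \<open>f y - f x\<close> gets
  the coefficient \<open>1 - \<tau>\<close>, which turns the \<open>f x\<close> of the gradient step into the \<open>f y\<close> of the previous
  state. The terms in \<open>(norm2 (x - xs))\<^sup>2\<close> that the mirror step adds are cancelled by strong convexity.

  The mirror noise that remains is \<open>\<tau> * \<beta>\<close>, which is about \<open>\<tau>\<^sup>2 / \<mu>\<close>, and must be at most a small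
  multiple of \<open>\<alpha>\<close>, hence of \<open>1 / S\<^sup>2\<close>. This is where the rate comes from: \<open>\<tau> = sqrt \<mu> / (8 * S)\<close> with
  \<open>\<alpha> = 1 / (4 * S\<^sup>2)\<close>. The memory contracts only at the rate of the smallest \<open>p i\<close>, which is no
  obstacle because \<open>\<mu> \<le> M $$ (i, i)\<close> (\<open>strong_convexity_le_diag\<close>) gives \<open>\<tau> \<le> p i / 8\<close>.
\<close>

section \<open>Quadratic forms and diagonal matrices\<close>

lemma scalar_prod_sum: "v \<in> carrier_vec n \<Longrightarrow> u \<bullet> v = (\<Sum>i<n. u $ i * v $ i)"
  by (simp add: scalar_prod_def atLeast0LessThan)

lemma norm2_sq_sum: "v \<in> carrier_vec n \<Longrightarrow> (norm2 v)\<^sup>2 = (\<Sum>i<n. (v $ i)\<^sup>2)"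
  by (simp add: norm2_def scalar_prod_def sum_nonneg power2_eq_square atLeast0LessThan)

lemma wnorm_sq_one: "v \<in> carrier_vec n \<Longrightarrow> wnorm_sq (1\<^sub>m n) v = (norm2 v)\<^sup>2"
  by (simp add: wnorm_sq_def norm2_def scalar_prod_def sum_nonneg)

lemma wnorm_sq_smult:
  assumes "W \<in> carrier_mat n n" "v \<in> carrier_vec n"
  shows "wnorm_sq W (c \<cdot>\<^sub>v v) = c\<^sup>2 * wnorm_sq W v"
  using assms by (simp add: wnorm_sq_def mult_mat_vec[of _ n n] power2_eq_square)

lemma wnorm_sq_add_unit:
  assumes W: "W \<in> carrier_mat n n" "transpose_mat W = W" and w: "w \<in> carrier_vec n" and i: "i < n"
  shows "wnorm_sq W (w + s \<cdot>\<^sub>v unit_vec n i) =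
    wnorm_sq W w + 2 * s * (W *\<^sub>v w) $ i + s\<^sup>2 * W $$ (i, i)"
proof -
  let ?e = "unit_vec n i :: rvec"
  have e: "?e \<in> carrier_vec n" by simp
  have Ww: "W *\<^sub>v w \<in> carrier_vec n" and We: "W *\<^sub>v ?e \<in> carrier_vec n"
    using W w by auto
  have ew: "?e \<bullet> (W *\<^sub>v w) = (W *\<^sub>v w) $ i"
    using scalar_prod_left_unit[OF Ww i] .
  have we: "w \<bullet> (W *\<^sub>v ?e) = (W *\<^sub>v w) $ i"
    using transpose_vec_mult_scalar[OF W(1) e w] W(2) scalar_prod_right_unit[OF i, of "W *\<^sub>v w"]
    by simp
  have ee: "?e \<bullet> (W *\<^sub>v ?e) = W $$ (i, i)"
    using W i by (simp add: scalar_prod_left_unit[of _ n])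
  have "W *\<^sub>v (w + s \<cdot>\<^sub>v ?e) = W *\<^sub>v w + s \<cdot>\<^sub>v (W *\<^sub>v ?e)"
    using W w by (simp add: mult_add_distrib_mat_vec[of _ n n] mult_mat_vec[of _ n n])
  then have "wnorm_sq W (w + s \<cdot>\<^sub>v ?e) =
      (w + s \<cdot>\<^sub>v ?e) \<bullet> (W *\<^sub>v w) + (w + s \<cdot>\<^sub>v ?e) \<bullet> (s \<cdot>\<^sub>v (W *\<^sub>v ?e))"
    unfolding wnorm_sq_def using W w Ww We
    by (simp add: scalar_prod_add_distrib[of _ n])
  also have "(w + s \<cdot>\<^sub>v ?e) \<bullet> (W *\<^sub>v w) = wnorm_sq W w + s * (W *\<^sub>v w) $ i"
    using W w Ww ew by (simp add: wnorm_sq_def add_scalar_prod_distrib[of _ n])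
  also have "(w + s \<cdot>\<^sub>v ?e) \<bullet> (s \<cdot>\<^sub>v (W *\<^sub>v ?e)) =
      s * (W *\<^sub>v w) $ i + s\<^sup>2 * W $$ (i, i)"
    using W w We we ee
    by (simp add: add_scalar_prod_distrib[of _ n] power2_eq_square algebra_simps)
  finally show ?thesis by simp
qed

lemma diag_powi_carrier [simp]: "diag_powi n p s \<in> carrier_mat n n"
  by (simp add: diag_powi_def)

lemma diag_powi_mult_index:
  assumes "v \<in> carrier_vec n" "j < n"
  shows "(diag_powi n p s *\<^sub>v v) $ j = p j powi s * v $ j"
proof -
  have "(diag_powi n p s *\<^sub>v v) $ j = (\<Sum>k = 0..<n. (if j = k then p k powi s else 0) * v $ k)"
    using assms by (simp add: diag_powi_def mat_diag_def scalar_prod_def)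
  also have "\<dots> = (\<Sum>k = 0..<n. if j = k then p k powi s * v $ k else 0)"
    by (rule sum.cong) auto
  finally show ?thesis using assms by simp
qed

lemma wnorm_sq_diag_powi:
  assumes "v \<in> carrier_vec n"
  shows "wnorm_sq (diag_powi n p s) v = (\<Sum>j<n. p j powi s * (v $ j)\<^sup>2)"
proof -
  have "dim_row (diag_powi n p s) = n"
    by (simp add: diag_powi_def mat_diag_def)
  then have "wnorm_sq (diag_powi n p s) v = (\<Sum>j<n. v $ j * (diag_powi n p s *\<^sub>v v) $ j)"
    by (simp add: wnorm_sq_def scalar_prod_def atLeast0LessThan)
  also have "\<dots> = (\<Sum>j<n. p j powi s * (v $ j)\<^sup>2)"
    using assms by (intro sum.cong) (auto simp: diag_powi_mult_index power2_eq_square)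
  finally show ?thesis .
qed

section \<open>Smoothness against strong convexity\<close>

lemma M_smooth_grad_carrier:
  assumes "M_smooth n M f" "x \<in> carrier_vec n"
  shows "grad n f x \<in> carrier_vec n"
  using assms grad_eqI unfolding M_smooth_def has_gradient_def by metis

text \<open>Comparing the upper and the lower model of \<open>f\<close> at one point along a coordinate axis. This is
  what keeps all sampling probabilities proportional to \<open>sqrt (M $$ (i, i))\<close> above a multiple of the
  contraction rate.\<close>

lemma strong_convexity_le_diag:
  assumes M: "pos_def_mat n M" and f: "M_smooth n M f" and sc: "strongly_convex n \<mu> f" and i: "i < n"
  shows "\<mu> \<le> M $$ (i, i)"
proof -
  let ?e = "unit_vec n i :: rvec" and ?o = "0\<^sub>v n :: rvec"
  have Mc: "M \<in> carrier_mat n n" using M by (simp add: pos_def_mat_def)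
  have c: "?e \<in> carrier_vec n" "?o \<in> carrier_vec n" by auto
  have e: "?e - ?o = ?e" by auto
  have "f ?o + grad n f ?o \<bullet> (?e - ?o) + \<mu>/2 * (norm2 (?e - ?o))\<^sup>2 \<le> f ?e"
    using sc c unfolding strongly_convex_def by blast
  also have "f ?e \<le> f ?o + grad n f ?o \<bullet> (?e - ?o) + 1/2 * wnorm_sq M (?e - ?o)"
    using f c unfolding M_smooth_def by blast
  finally have "\<mu> * (norm2 ?e)\<^sup>2 \<le> wnorm_sq M ?e" by (simp add: e)
  moreover have "(norm2 ?e)\<^sup>2 = 1"
    using i by (simp add: norm2_def)
  moreover have "wnorm_sq M ?e = M $$ (i, i)"
    using Mc i by (simp add: wnorm_sq_def scalar_prod_left_unit[of _ n])
  ultimately show ?thesis by simp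
qed

section \<open>The SEGA gradient estimator\<close>

text \<open>The target \<open>v\<close> and the memory \<open>w\<close> are arbitrary, so that a diagonal preconditioner can be
  absorbed: scaling the estimator of \<open>v\<close> coordinatewise gives the estimator of the scaled \<open>v\<close> with
  the scaled memory. Hence one moment bound serves both \<open>g\<close> and its preconditioned version.\<close>

definition coord_estimator :: "nat \<Rightarrow> (nat \<Rightarrow> real) \<Rightarrow> rvec \<Rightarrow> rvec \<Rightarrow> nat \<Rightarrow> rvec" where
  "coord_estimator n p v w i = w + (1 / p i * (v $ i - w $ i)) \<cdot>\<^sub>v unit_vec n i"

lemma coord_estimator_carrier [simp]:
  "w \<in> carrier_vec n \<Longrightarrow> coord_estimator n p v w i \<in> carrier_vec n"
  by (simp add: coord_estimator_def)

locale coordinate_sampling =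
  fixes n :: nat and p :: "nat \<Rightarrow> real"
  assumes p_pos: "i < n \<Longrightarrow> p i > 0" and sum_p: "(\<Sum>i<n. p i) = 1"
begin

abbreviation mean :: "(nat \<Rightarrow> real) \<Rightarrow> real" where
  "mean X \<equiv> (\<Sum>i<n. p i * X i)"

definition dual_sq :: "rvec \<Rightarrow> real" where
  "dual_sq v = (\<Sum>i<n. (v $ i)\<^sup>2 / p i)"

lemma dual_sq_nonneg: "dual_sq v \<ge> 0"
  unfolding dual_sq_def by (intro sum_nonneg) (auto simp: p_pos less_imp_le)

lemma mean_const: "mean (\<lambda>_. c) = c"
  by (simp add: sum_distrib_right[symmetric] sum_p)

lemma mean_mono: "(\<And>i. i < n \<Longrightarrow> X i \<le> Y i) \<Longrightarrow> mean X \<le> mean Y"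
  by (intro sum_mono mult_left_mono) (auto simp: p_pos less_imp_le)

lemma mean_add: "mean (\<lambda>i. X i + Y i) = mean X + mean Y"
  by (simp add: distrib_left sum.distrib)

lemma mean_diff: "mean (\<lambda>i. X i - Y i) = mean X - mean Y"
  by (simp add: right_diff_distrib sum_subtractf)

lemma mean_mult: "mean (\<lambda>i. c * X i) = c * mean X"
  by (simp add: sum_distrib_left mult_ac)

lemma mean_estimator_scalar_prod:
  assumes u: "u \<in> carrier_vec n" and v: "v \<in> carrier_vec n" and w: "w \<in> carrier_vec n"
  shows "mean (\<lambda>i. u \<bullet> coord_estimator n p v w i) = u \<bullet> v"
proof -
  have "u \<bullet> coord_estimator n p v w i = u \<bullet> w + 1 / p i * (u $ i * (v $ i - w $ i))"
    if "i < n" for i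
    using that u w scalar_prod_right_unit[OF that]
    by (simp add: coord_estimator_def scalar_prod_add_distrib[of _ n] mult_ac)
  then have "mean (\<lambda>i. u \<bullet> coord_estimator n p v w i) =
      mean (\<lambda>i. u \<bullet> w + 1 / p i * (u $ i * (v $ i - w $ i)))"
    by simp
  also have "\<dots> = u \<bullet> w + mean (\<lambda>i. 1 / p i * (u $ i * (v $ i - w $ i)))"
    by (simp only: mean_add mean_const)
  also have "mean (\<lambda>i. 1 / p i * (u $ i * (v $ i - w $ i))) = (\<Sum>i<n. u $ i * (v $ i - w $ i))"
    by (rule sum.cong) (use p_pos in \<open>auto simp: less_imp_neq\<close>, metis less_irrefl p_pos)
  also have "\<dots> = u \<bullet> v - u \<bullet> w"
    using u v w by (simp add: scalar_prod_def atLeast0LessThan right_diff_distrib sum_subtractf)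
  finally show ?thesis by simp
qed

text \<open>With \<open>A = v $ i / p i\<close> and \<open>B = w $ i / p i\<close> the estimator is
  \<open>A \<cdot>\<^sub>v e - (B \<cdot>\<^sub>v e - w)\<close> for \<open>e = unit_vec n i\<close>. The parallelogram inequality bounds its form by twice
  the forms of the two parts. The second part is an unbiased one-coordinate estimator of \<open>w\<close> minus its
  mean, and a variance is at most the second moment.\<close>

lemma mean_estimator_wnorm_sq:
  assumes W: "W \<in> carrier_mat n n" "transpose_mat W = W"
    and psd: "\<And>u. u \<in> carrier_vec n \<Longrightarrow> wnorm_sq W u \<ge> 0"
    and w: "w \<in> carrier_vec n"
  shows "mean (\<lambda>i. wnorm_sq W (coord_estimator n p v w i)) \<le>
    2 * (\<Sum>i<n. W $$ (i, i) / p i * (v $ i)\<^sup>2) + 2 * (\<Sum>i<n. W $$ (i, i) / p i * (w $ i)\<^sup>2)"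
proof -
  define l where "l = W *\<^sub>v w"
  define A where "A i = v $ i / p i" for i
  define B where "B i = w $ i / p i" for i
  have "wnorm_sq W (coord_estimator n p v w i) \<le>
      2 * ((A i)\<^sup>2 * W $$ (i, i)) + (2 * wnorm_sq W w - 4 * (B i * l $ i) + 2 * ((B i)\<^sup>2 * W $$ (i, i)))"
    if i: "i < n" for i
  proof -
    have "coord_estimator n p v w i = w + (A i - B i) \<cdot>\<^sub>v unit_vec n i"
      by (simp add: coord_estimator_def A_def B_def diff_divide_distrib)
    \<comment> \<open>This nonnegative form is exactly the gap in the parallelogram inequality.\<close>
    moreover have "0 \<le> wnorm_sq W (w + (- (A i + B i)) \<cdot>\<^sub>v unit_vec n i)"
      using psd w by simp
    ultimately show ?thesis
      unfolding wnorm_sq_add_unit[OF W w i] l_def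
      by (simp add: wnorm_sq_add_unit[OF W w i] power2_eq_square algebra_simps)
  qed
  then have "mean (\<lambda>i. wnorm_sq W (coord_estimator n p v w i)) \<le>
      mean (\<lambda>i. 2 * ((A i)\<^sup>2 * W $$ (i, i)) +
        (2 * wnorm_sq W w - 4 * (B i * l $ i) + 2 * ((B i)\<^sup>2 * W $$ (i, i))))"
    by (rule mean_mono)
  also have "\<dots> = 2 * mean (\<lambda>i. (A i)\<^sup>2 * W $$ (i, i)) +
      (2 * wnorm_sq W w - 4 * mean (\<lambda>i. B i * l $ i) + 2 * mean (\<lambda>i. (B i)\<^sup>2 * W $$ (i, i)))"
    by (simp only: mean_add mean_diff mean_mult mean_const)
  also have "mean (\<lambda>i. B i * l $ i) = w \<bullet> l"
  proof -
    have "l \<in> carrier_vec n" using W w by (simp add: l_def)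
    moreover have "mean (\<lambda>i. B i * l $ i) = (\<Sum>i<n. w $ i * l $ i)"
      by (rule sum.cong) (use p_pos in \<open>auto simp: B_def less_imp_neq[symmetric]\<close>)
    ultimately show ?thesis by (simp add: scalar_prod_def atLeast0LessThan)
  qed
  also have "w \<bullet> l = wnorm_sq W w" by (simp add: wnorm_sq_def l_def)
  also have "mean (\<lambda>i. (A i)\<^sup>2 * W $$ (i, i)) = (\<Sum>i<n. W $$ (i, i) / p i * (v $ i)\<^sup>2)"
    by (rule sum.cong) (use p_pos in \<open>auto simp: A_def power2_eq_square less_imp_neq[symmetric]\<close>)
  also have "mean (\<lambda>i. (B i)\<^sup>2 * W $$ (i, i)) = (\<Sum>i<n. W $$ (i, i) / p i * (w $ i)\<^sup>2)"
    by (rule sum.cong) (use p_pos in \<open>auto simp: B_def power2_eq_square less_imp_neq[symmetric]\<close>)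
  finally show ?thesis using psd[OF w] by linarith
qed

lemma mean_estimator_norm2_sq:
  assumes "w \<in> carrier_vec n"
  shows "mean (\<lambda>i. (norm2 (coord_estimator n p v w i))\<^sup>2) \<le> 2 * (dual_sq v + dual_sq w)"
proof -
  have "mean (\<lambda>i. wnorm_sq (1\<^sub>m n) (coord_estimator n p v w i)) \<le>
    2 * (\<Sum>i<n. (1\<^sub>m n) $$ (i, i) / p i * (v $ i)\<^sup>2) + 2 * (\<Sum>i<n. (1\<^sub>m n) $$ (i, i) / p i * (w $ i)\<^sup>2)"
    by (rule mean_estimator_wnorm_sq) (use assms in \<open>auto simp: wnorm_sq_one\<close>)
  then show ?thesis
    using assms by (simp add: wnorm_sq_one dual_sq_def)
qed

text \<open>The update of \<open>h\<close> replaces \<open>h $ i\<close> by \<open>v $ i\<close>. The weight \<open>1 / (p i)\<^sup>2\<close> times the probability \<open>p i\<close> of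
  doing so leaves the weight \<open>1 / p i\<close> of \<open>dual_sq\<close>; this is why the exponent \<open>-2\<close> is the right one in
  the Lyapunov function.\<close>

lemma mean_gradient_memory:
  assumes h: "h \<in> carrier_vec n"
  shows "mean (\<lambda>i. wnorm_sq (diag_powi n p (-2)) (h + (v $ i - h $ i) \<cdot>\<^sub>v unit_vec n i)) =
    wnorm_sq (diag_powi n p (-2)) h - dual_sq h + dual_sq v"
proof -
  let ?N = "\<lambda>u. wnorm_sq (diag_powi n p (-2)) u"
  have "?N (h + (v $ i - h $ i) \<cdot>\<^sub>v unit_vec n i) = ?N h + ((v $ i)\<^sup>2 - (h $ i)\<^sup>2) / (p i)\<^sup>2"
    if i: "i < n" for i
  proof -
    have "?N (h + (v $ i - h $ i) \<cdot>\<^sub>v unit_vec n i) =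
      (\<Sum>j<n. p j powi (-2) * (h $ j)\<^sup>2 + (if j = i then p i powi (-2) * ((v $ i)\<^sup>2 - (h $ i)\<^sup>2) else 0))"
      using h i by (subst wnorm_sq_diag_powi) (auto intro!: sum.cong simp: algebra_simps)
    also have "\<dots> = ?N h + p i powi (-2) * ((v $ i)\<^sup>2 - (h $ i)\<^sup>2)"
      using h i by (simp add: sum.distrib wnorm_sq_diag_powi)
    finally show ?thesis by (simp add: power_int_minus field_simps)
  qed
  then have "mean (\<lambda>i. ?N (h + (v $ i - h $ i) \<cdot>\<^sub>v unit_vec n i)) =
      mean (\<lambda>i. ?N h + ((v $ i)\<^sup>2 - (h $ i)\<^sup>2) / (p i)\<^sup>2)"
    by simp
  also have "\<dots> = ?N h + (\<Sum>i<n. (v $ i)\<^sup>2 / p i - (h $ i)\<^sup>2 / p i)"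
    unfolding mean_add mean_const
    by (intro arg_cong2[where f = "(+)"] sum.cong refl)
      (use p_pos in \<open>auto simp: power2_eq_square right_diff_distrib diff_divide_distrib less_imp_neq[symmetric]\<close>)
  finally show ?thesis by (simp add: dual_sq_def sum_subtractf)
qed

text \<open>The new distance vector is \<open>(w - \<beta> \<cdot>\<^sub>v g) / (1 + \<theta>)\<close> with \<open>w = (z - xs) + \<theta> \<cdot>\<^sub>v (x - xs)\<close>. The square is
  expanded around \<open>w\<close>, the estimator being unbiased, and \<open>(norm2 w)\<^sup>2\<close> is bounded by convexity, at the
  cost of one of the two factors \<open>1 + \<theta>\<close> in the denominator.\<close>

lemma mean_mirror_step:
  assumes z: "z \<in> carrier_vec n" and x: "x \<in> carrier_vec n" and xs: "xs \<in> carrier_vec n"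
    and v: "v \<in> carrier_vec n" and h: "h \<in> carrier_vec n" and \<theta>: "\<theta> \<ge> 0"
  shows "mean (\<lambda>i. (norm2 ((1 / (1 + \<theta>)) \<cdot>\<^sub>v (z + \<theta> \<cdot>\<^sub>v x - \<beta> \<cdot>\<^sub>v coord_estimator n p v h i) - xs))\<^sup>2) \<le>
    ((norm2 (z - xs))\<^sup>2 + \<theta> * (norm2 (x - xs))\<^sup>2) / (1 + \<theta>)
    + (1 / (1 + \<theta>))\<^sup>2 * (2 * \<beta>\<^sup>2 * (dual_sq v + dual_sq h) - 2 * \<beta> * (((z - xs) + \<theta> \<cdot>\<^sub>v (x - xs)) \<bullet> v))"
proof -
  define w where "w = (z - xs) + \<theta> \<cdot>\<^sub>v (x - xs)"
  have w: "w \<in> carrier_vec n" using z x xs by (simp add: w_def)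
  let ?g = "coord_estimator n p v h"
  have t: "1 + \<theta> > 0" using \<theta> by simp
  have eq: "(norm2 ((1 / (1 + \<theta>)) \<cdot>\<^sub>v (z + \<theta> \<cdot>\<^sub>v x - \<beta> \<cdot>\<^sub>v ?g i) - xs))\<^sup>2 =
      (1 / (1 + \<theta>))\<^sup>2 * ((norm2 w)\<^sup>2 - 2 * \<beta> * (w \<bullet> ?g i) + \<beta>\<^sup>2 * (norm2 (?g i))\<^sup>2)" for i
  proof -
    define g where "g = ?g i"
    have g: "g \<in> carrier_vec n" using h by (simp add: g_def)
    have "(norm2 ((1 / (1 + \<theta>)) \<cdot>\<^sub>v (z + \<theta> \<cdot>\<^sub>v x - \<beta> \<cdot>\<^sub>v g) - xs))\<^sup>2 =
        (\<Sum>j<n. (1 / (1 + \<theta>) * (z $ j + \<theta> * x $ j - \<beta> * g $ j) - xs $ j)\<^sup>2)"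
      using z x xs g by (subst norm2_sq_sum[of _ n]) auto
    also have "\<dots> = (\<Sum>j<n. (1 / (1 + \<theta>))\<^sup>2 * ((w $ j)\<^sup>2 - 2 * \<beta> * (w $ j * g $ j) + \<beta>\<^sup>2 * (g $ j)\<^sup>2))"
    proof (rule sum.cong)
      fix j assume "j \<in> {..<n}"
      then have j: "j < n" by simp
      have "1 / (1 + \<theta>) * (z $ j + \<theta> * x $ j - \<beta> * g $ j) - xs $ j = 1 / (1 + \<theta>) * (w $ j - \<beta> * g $ j)"
        using j z x xs t by (simp add: w_def field_simps)
      then show "(1 / (1 + \<theta>) * (z $ j + \<theta> * x $ j - \<beta> * g $ j) - xs $ j)\<^sup>2 =
          (1 / (1 + \<theta>))\<^sup>2 * ((w $ j)\<^sup>2 - 2 * \<beta> * (w $ j * g $ j) + \<beta>\<^sup>2 * (g $ j)\<^sup>2)"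
        by (simp only: power_mult_distrib) (simp add: power2_eq_square algebra_simps)
    qed simp
    also have "\<dots> = (1 / (1 + \<theta>))\<^sup>2 * ((norm2 w)\<^sup>2 - 2 * \<beta> * (w \<bullet> g) + \<beta>\<^sup>2 * (norm2 g)\<^sup>2)"
      using w g by (simp add: norm2_sq_sum[of _ n] scalar_prod_def atLeast0LessThan
          sum.distrib sum_subtractf flip: sum_distrib_left sum_divide_distrib)
    finally show ?thesis by (simp add: g_def)
  qed
  have ww: "(norm2 w)\<^sup>2 \<le> (1 + \<theta>) * ((norm2 (z - xs))\<^sup>2 + \<theta> * (norm2 (x - xs))\<^sup>2)"
  proof -
    have "(w $ j)\<^sup>2 \<le> (1 + \<theta>) * (((z - xs) $ j)\<^sup>2 + \<theta> * ((x - xs) $ j)\<^sup>2)" if "j < n" for j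
    proof -
      have "0 \<le> \<theta> * ((z - xs) $ j - (x - xs) $ j)\<^sup>2" using \<theta> by simp
      moreover have "w $ j = (z - xs) $ j + \<theta> * (x - xs) $ j"
        using that z x xs by (simp add: w_def)
      ultimately show ?thesis by (simp add: power2_eq_square algebra_simps)
    qed
    then have "(\<Sum>j<n. (w $ j)\<^sup>2) \<le> (\<Sum>j<n. (1 + \<theta>) * (((z - xs) $ j)\<^sup>2 + \<theta> * ((x - xs) $ j)\<^sup>2))"
      by (intro sum_mono) simp
    then show ?thesis
      using w z x xs by (simp only: norm2_sq_sum[of _ n] minus_carrier_vec sum.distrib flip: sum_distrib_left)
  qed
  have "mean (\<lambda>i. (norm2 ((1 / (1 + \<theta>)) \<cdot>\<^sub>v (z + \<theta> \<cdot>\<^sub>v x - \<beta> \<cdot>\<^sub>v ?g i) - xs))\<^sup>2) =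
      (1 / (1 + \<theta>))\<^sup>2 * ((norm2 w)\<^sup>2 - 2 * \<beta> * (w \<bullet> v) + \<beta>\<^sup>2 * mean (\<lambda>i. (norm2 (?g i))\<^sup>2))"
    unfolding eq by (simp only: mean_add mean_diff mean_mult mean_const mean_estimator_scalar_prod[OF w v h])
  also have "\<dots> \<le> (1 / (1 + \<theta>))\<^sup>2 * ((1 + \<theta>) * ((norm2 (z - xs))\<^sup>2 + \<theta> * (norm2 (x - xs))\<^sup>2)
      - 2 * \<beta> * (w \<bullet> v) + \<beta>\<^sup>2 * (2 * (dual_sq v + dual_sq h)))"
    by (intro mult_left_mono add_mono diff_mono order_refl ww mean_estimator_norm2_sq h) auto
  also have "\<dots> = ((norm2 (z - xs))\<^sup>2 + \<theta> * (norm2 (x - xs))\<^sup>2) / (1 + \<theta>)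
      + (1 / (1 + \<theta>))\<^sup>2 * (2 * \<beta>\<^sup>2 * (dual_sq v + dual_sq h) - 2 * \<beta> * (w \<bullet> v))"
  proof -
    have "(1 / (1 + \<theta>))\<^sup>2 * (1 + \<theta>) = 1 / (1 + \<theta>)" using t by (simp add: power2_eq_square)
    then have "(1 / (1 + \<theta>))\<^sup>2 * ((1 + \<theta>) * N) = N / (1 + \<theta>)" for N
      by (metis mult.assoc mult.left_neutral times_divide_eq_left)
    then show ?thesis by (simp only: distrib_left right_diff_distrib) (simp add: add_divide_distrib)
  qed
  finally show ?thesis by (simp add: w_def)
qed

text \<open>Smoothness at \<open>x\<close>, averaged over the coordinate. The hypothesis on the diagonal of \<open>M\<close> is what
  the sampling proportional to \<open>sqrt (M $$ (i, i))\<close> provides, with \<open>s\<close> the normalizing sum.\<close>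

lemma mean_gradient_step:
  assumes M: "pos_def_mat n M" and diag: "\<And>i. i < n \<Longrightarrow> M $$ (i, i) = (p i)\<^sup>2 * s\<^sup>2"
    and f: "M_smooth n M f" and x: "x \<in> carrier_vec n" and h: "h \<in> carrier_vec n"
  shows "mean (\<lambda>i. f (x - \<alpha> \<cdot>\<^sub>v (diag_powi n p (-1) *\<^sub>v coord_estimator n p (grad n f x) h i))) \<le>
    f x - \<alpha> * dual_sq (grad n f x) + \<alpha>\<^sup>2 * s\<^sup>2 * (dual_sq (grad n f x) + dual_sq h)"
proof -
  let ?D = "diag_powi n p (-1)"
  define v where "v = grad n f x"
  have v: "v \<in> carrier_vec n"
    using M_smooth_grad_carrier[OF f x] by (simp add: v_def)
  have D: "?D *\<^sub>v u \<in> carrier_vec n" if "u \<in> carrier_vec n" for u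
    using that by (intro mult_mat_vec_carrier[of _ n n]) auto
  have D_index: "(?D *\<^sub>v u) $ j = u $ j / p j" if "u \<in> carrier_vec n" "j < n" for u j
    using diag_powi_mult_index[OF that, of p "-1"] by (simp add: power_int_minus field_simps)
  let ?g = "coord_estimator n p (?D *\<^sub>v v) (?D *\<^sub>v h)"
  have g: "?g i \<in> carrier_vec n" for i using D h by simp
  have Dg: "?D *\<^sub>v coord_estimator n p v h i = ?g i" if i: "i < n" for i
  proof (rule eq_vecI)
    fix j assume "j < dim_vec (?g i)"
    then have j: "j < n" using g[of i] by auto
    then show "(?D *\<^sub>v coord_estimator n p v h i) $ j = ?g i $ j"
      using v h i j D[OF h] D_index[of "coord_estimator n p v h i" j] D_index[OF v i] D_index[OF h i]
        D_index[OF h j] by (simp add: coord_estimator_def add_divide_distrib diff_divide_distrib)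
  qed (use D[of "coord_estimator n p v h i"] g[of i] h in \<open>auto simp: diag_powi_def mat_diag_def\<close>)
  have "f (x - \<alpha> \<cdot>\<^sub>v (?D *\<^sub>v coord_estimator n p v h i)) \<le>
      f x - \<alpha> * (v \<bullet> ?g i) + \<alpha>\<^sup>2 / 2 * wnorm_sq M (?g i)" if i: "i < n" for i
  proof -
    have "x - \<alpha> \<cdot>\<^sub>v ?g i - x = (-\<alpha>) \<cdot>\<^sub>v ?g i"
      using x g[of i] by (intro eq_vecI) auto
    moreover have "f (x - \<alpha> \<cdot>\<^sub>v ?g i) \<le> f x + v \<bullet> (x - \<alpha> \<cdot>\<^sub>v ?g i - x)
        + 1/2 * wnorm_sq M (x - \<alpha> \<cdot>\<^sub>v ?g i - x)"
      using f x g[of i] unfolding M_smooth_def v_def by auto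
    moreover have "v \<bullet> ((-\<alpha>) \<cdot>\<^sub>v ?g i) = - \<alpha> * (v \<bullet> ?g i)"
      using v g[of i] by (intro scalar_prod_smult_distrib)
    moreover have "wnorm_sq M ((-\<alpha>) \<cdot>\<^sub>v ?g i) = \<alpha>\<^sup>2 * wnorm_sq M (?g i)"
      using M g[of i] by (simp add: wnorm_sq_smult[of _ n] pos_def_mat_def)
    ultimately show ?thesis by (simp add: Dg[OF i])
  qed
  then have "mean (\<lambda>i. f (x - \<alpha> \<cdot>\<^sub>v (?D *\<^sub>v coord_estimator n p v h i))) \<le>
      mean (\<lambda>i. f x - \<alpha> * (v \<bullet> ?g i) + \<alpha>\<^sup>2 / 2 * wnorm_sq M (?g i))"
    by (rule mean_mono)
  also have "\<dots> = f x - \<alpha> * (v \<bullet> (?D *\<^sub>v v)) + \<alpha>\<^sup>2 / 2 * mean (\<lambda>i. wnorm_sq M (?g i))"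
    by (simp only: mean_add mean_diff mean_mult mean_const mean_estimator_scalar_prod[OF v D[OF v] D[OF h]])
  also have "v \<bullet> (?D *\<^sub>v v) = dual_sq v"
    using D_index[OF v]
    by (simp add: scalar_prod_sum[OF D[OF v]] dual_sq_def power2_eq_square)
  also have "mean (\<lambda>i. wnorm_sq M (?g i)) \<le> 2 * (s\<^sup>2 * dual_sq v) + 2 * (s\<^sup>2 * dual_sq h)"
  proof -
    have "wnorm_sq M u \<ge> 0" if u: "u \<in> carrier_vec n" for u
    proof (cases "u = 0\<^sub>v n")
      case True
      have "M *\<^sub>v 0\<^sub>v n \<in> carrier_vec n" 
        using M by (intro mult_mat_vec_carrier[of _ n n]) (auto simp: pos_def_mat_def)
      then show ?thesis using True by (simp add: wnorm_sq_def)
    next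
      case False
      then show ?thesis using M u by (simp add: wnorm_sq_def pos_def_mat_def less_imp_le)
    qed
    moreover have "(\<Sum>i<n. M $$ (i, i) / p i * ((?D *\<^sub>v u) $ i)\<^sup>2) = s\<^sup>2 * dual_sq u"
      if "u \<in> carrier_vec n" for u
      unfolding dual_sq_def sum_distrib_left
      by (rule sum.cong) (use p_pos D_index[OF that] in
          \<open>auto simp: diag power2_eq_square less_imp_neq[symmetric]\<close>)
    ultimately show ?thesis
      using mean_estimator_wnorm_sq[of M "?D *\<^sub>v h" "?D *\<^sub>v v"] M v h D[OF h]
      by (simp add: pos_def_mat_def)
  qed
  finally have "mean (\<lambda>i. f (x - \<alpha> \<cdot>\<^sub>v (?D *\<^sub>v coord_estimator n p v h i))) \<le>
      f x - \<alpha> * dual_sq v + \<alpha>\<^sup>2 / 2 * (2 * (s\<^sup>2 * dual_sq v) + 2 * (s\<^sup>2 * dual_sq h))"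
    by (simp add: mult_left_mono)
  then show ?thesis by (simp add: v_def algebra_simps)
qed

section \<open>Contraction of the Lyapunov function in one step\<close>

text \<open>The three mean estimates are added. What is left to see is that the terms in \<open>f x\<close>, \<open>f y\<close> and
  \<open>f xs\<close> add up to at most \<open>(1 - \<tau>) * (f y - f xs)\<close> (\<open>cross\<close>), that each squared norm in the Lyapunov
  function shrinks by \<open>1 - \<tau>\<close>, and that the gain of the gradient step dominates all noise (\<open>noise\<close>).\<close>

lemma asega_contraction:
  assumes M: "pos_def_mat n M" and diag: "\<And>i. i < n \<Longrightarrow> M $$ (i, i) = (p i)\<^sup>2 * s\<^sup>2" and s: "s > 0"
    and f: "M_smooth n M f" and \<mu>: "\<mu> > 0" and sc: "strongly_convex n \<mu> f"
    and xs: "is_minimizer n f xs"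
    and \<tau>: "0 < \<tau>" "\<tau> \<le> 1 / 8" "\<And>i. i < n \<Longrightarrow> \<tau> \<le> p i / 8" "\<tau>\<^sup>2 = \<mu> / (64 * s\<^sup>2)"
    and \<alpha>: "\<alpha> = 1 / (4 * s\<^sup>2)" and \<beta>: "\<beta> = \<tau> / ((1 - \<tau>) * \<mu>)"
    and \<Upsilon>: "\<Upsilon> = lyapunov n f p xs 1 (\<mu> / (2 * (1 - \<tau>))) (1 / (8 * s\<^sup>2))"
    and y: "y \<in> carrier_vec n" and z: "z \<in> carrier_vec n" and h: "h \<in> carrier_vec n"
  shows "mean (\<lambda>i. \<Upsilon> (asega_update n f p \<alpha> \<beta> \<tau> \<mu> i (y, z, h))) \<le> (1 - \<tau>) * \<Upsilon> (y, z, h)"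
proof -
  define x where "x = (1 - \<tau>) \<cdot>\<^sub>v y + \<tau> \<cdot>\<^sub>v z"
  define v where "v = grad n f x"
  define \<theta> where "\<theta> = \<beta> * \<mu>"
  define B where "B = \<mu> / (2 * (1 - \<tau>))"
  define r where "r = 1 / s\<^sup>2"
  define wd where "wd = (z - xs) + \<theta> \<cdot>\<^sub>v (x - xs)"
  let ?g = "coord_estimator n p v h"
  let ?y = "\<lambda>i. x - \<alpha> \<cdot>\<^sub>v (diag_powi n p (-1) *\<^sub>v ?g i)"
  let ?z = "\<lambda>i. (1 / (1 + \<theta>)) \<cdot>\<^sub>v (z + \<theta> \<cdot>\<^sub>v x - \<beta> \<cdot>\<^sub>v ?g i)"
  let ?h = "\<lambda>i. h + (v $ i - h $ i) \<cdot>\<^sub>v unit_vec n i"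
  let ?H = "wnorm_sq (diag_powi n p (-2))"
  let ?N = "(norm2 (x - xs))\<^sup>2" and ?Z = "(norm2 (z - xs))\<^sup>2"
  let ?G = "dual_sq v + dual_sq h"
  have xsc: "xs \<in> carrier_vec n" and xs_le: "f xs \<le> f x"
    using xs y z by (auto simp: is_minimizer_def x_def)
  have x: "x \<in> carrier_vec n" using y z by (simp add: x_def)
  have v: "v \<in> carrier_vec n" using M_smooth_grad_carrier[OF f x] by (simp add: v_def)
  have \<kappa>: "1 - \<tau> > 0" using \<tau> by simp
  have \<theta>: "\<theta> = \<tau> / (1 - \<tau>)" using \<mu> by (simp add: \<theta>_def \<beta>)
  have \<theta>0: "\<theta> > 0" using \<theta> \<kappa> \<tau> by simp
  have \<theta>1: "1 / (1 + \<theta>) = 1 - \<tau>"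
  proof -
    have "1 + \<theta> = 1 / (1 - \<tau>)" unfolding \<theta> using \<kappa> by (simp add: field_simps)
    then show ?thesis by simp
  qed
  have \<theta>\<tau>: "\<tau> \<le> \<theta>" unfolding \<theta> using \<tau> by (simp add: field_simps)
  have B0: "B > 0" using \<mu> \<kappa> by (simp add: B_def)
  have r: "r > 0" using s by (simp add: r_def)
  have upd: "asega_update n f p \<alpha> \<beta> \<tau> \<mu> i (y, z, h) = (?y i, ?z i, ?h i)" if i: "i < n" for i
  proof -
    have "unit_vec n i \<bullet> (grad n f x - h) = v $ i - h $ i"
      using i v h by (simp add: scalar_prod_left_unit[of _ n] v_def)
    then show ?thesis
      by (simp add: asega_update_def Let_def coord_estimator_def \<theta>_def v_def flip: x_def)
  qed
  have "mean (\<lambda>i. \<Upsilon> (asega_update n f p \<alpha> \<beta> \<tau> \<mu> i (y, z, h))) =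
      mean (\<lambda>i. (f (?y i) - f xs) + B * (norm2 (?z i - xs))\<^sup>2 + r / 8 * ?H (?h i))"
    using upd by (intro sum.cong refl) (simp add: \<Upsilon> lyapunov_def B_def r_def)
  also have "\<dots> = (mean (\<lambda>i. f (?y i)) - f xs) + B * mean (\<lambda>i. (norm2 (?z i - xs))\<^sup>2)
      + r / 8 * mean (\<lambda>i. ?H (?h i))"
    by (simp only: mean_add mean_diff mean_mult mean_const)
  also have "mean (\<lambda>i. ?H (?h i)) = ?H h - dual_sq h + dual_sq v"
    by (rule mean_gradient_memory[OF h])
  finally have total: "mean (\<lambda>i. \<Upsilon> (asega_update n f p \<alpha> \<beta> \<tau> \<mu> i (y, z, h))) =
      (mean (\<lambda>i. f (?y i)) - f xs) + B * mean (\<lambda>i. (norm2 (?z i - xs))\<^sup>2)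
      + r / 8 * (?H h - dual_sq h + dual_sq v)" .

  have f_step: "mean (\<lambda>i. f (?y i)) \<le> f x - r / 4 * dual_sq v + r / 16 * ?G"
  proof -
    have "\<alpha>\<^sup>2 * s\<^sup>2 = r / 16"
      using s by (simp add: \<alpha> r_def power2_eq_square)
    moreover have "\<alpha> * dual_sq v = r / 4 * dual_sq v"
      by (simp add: \<alpha> r_def)
    moreover have "mean (\<lambda>i. f (?y i)) \<le> f x - \<alpha> * dual_sq v + \<alpha>\<^sup>2 * s\<^sup>2 * ?G"
      unfolding v_def by (rule mean_gradient_step[OF M diag f x h])
    ultimately show ?thesis by (simp only:)
  qed

  \<comment> \<open>The term in \<open>?N\<close> is kept: it cancels the \<open>\<theta> * ?N\<close> that the mirror step adds.\<close>
  have cross: "\<tau> * (wd \<bullet> v) \<ge> \<theta> * (f x - f xs + \<mu> / 2 * ?N) + (1 - \<tau>) * (f x - f y)"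
  proof -
    have lb: "(x - u) \<bullet> v \<ge> f x - f u + \<mu> / 2 * (norm2 (x - u))\<^sup>2" if u: "u \<in> carrier_vec n" for u
    proof -
      have "f u \<ge> f x + v \<bullet> (u - x) + \<mu> / 2 * (norm2 (u - x))\<^sup>2"
        using sc x u unfolding strongly_convex_def v_def by blast
      moreover have "(norm2 (u - x))\<^sup>2 = (norm2 (x - u))\<^sup>2"
        using x u by (simp add: norm2_sq_sum[of _ n] power2_commute)
      moreover have "v \<bullet> (u - x) = - ((x - u) \<bullet> v)"
        using x u v by (simp add: minus_scalar_prod_distrib[of _ n] scalar_prod_minus_distrib[of _ n]
            comm_scalar_prod[of v n])
      ultimately show ?thesis by simp
    qed
    have "\<mu> / 2 * (norm2 (x - y))\<^sup>2 \<ge> 0" using \<mu> by simp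
    then have "(x - y) \<bullet> v \<ge> f x - f y" using lb[OF y] by linarith
    \<comment> \<open>Since \<open>x\<close> averages \<open>y\<close> and \<open>z\<close>, the vector \<open>\<tau> \<cdot>\<^sub>v (z - x)\<close> is \<open>(1 - \<tau>) \<cdot>\<^sub>v (x - y)\<close>: the mirror direction
      splits into the direction towards the minimizer and the one towards \<open>y\<close>.\<close>
    moreover have "\<tau> \<cdot>\<^sub>v wd = \<theta> \<cdot>\<^sub>v (x - xs) + (1 - \<tau>) \<cdot>\<^sub>v (x - y)"
    proof (rule eq_vecI)
      fix j assume "j < dim_vec (\<theta> \<cdot>\<^sub>v (x - xs) + (1 - \<tau>) \<cdot>\<^sub>v (x - y))"
      then have j: "j < n" using y by simp
      have "x $ j = (1 - \<tau>) * y $ j + \<tau> * z $ j" using j y z by (simp add: x_def)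
      then have "\<tau> * (z $ j - x $ j) = (1 - \<tau>) * (x $ j - y $ j)"
        by (simp add: algebra_simps)
      moreover have "\<theta> * (x $ j - xs $ j) = (\<tau> + \<tau> * \<theta>) * (x $ j - xs $ j)"
        using \<theta> \<kappa> by (simp add: field_simps)
      ultimately have "\<tau> * (z $ j - xs $ j + \<theta> * (x $ j - xs $ j)) =
          \<theta> * (x $ j - xs $ j) + (1 - \<tau>) * (x $ j - y $ j)"
        by (simp add: algebra_simps)
      then show "(\<tau> \<cdot>\<^sub>v wd) $ j = (\<theta> \<cdot>\<^sub>v (x - xs) + (1 - \<tau>) \<cdot>\<^sub>v (x - y)) $ j"
        using j x y z xsc by (simp add: wd_def)
    qed (use x y z xsc in \<open>auto simp: wd_def\<close>)
    then have "\<tau> * (wd \<bullet> v) = \<theta> * ((x - xs) \<bullet> v) + (1 - \<tau>) * ((x - y) \<bullet> v)"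
    proof -
      have "\<tau> * (wd \<bullet> v) = (\<tau> \<cdot>\<^sub>v wd) \<bullet> v" using x z xsc v by (simp add: wd_def)
      then show ?thesis
        using x y xsc v \<open>\<tau> \<cdot>\<^sub>v wd = _\<close> by (simp add: add_scalar_prod_distrib[of _ n])
    qed
    ultimately show ?thesis
      using lb[OF xsc] \<theta>0 \<kappa> by (simp add: add_mono mult_left_mono)
  qed

  have z_step: "B * mean (\<lambda>i. (norm2 (?z i - xs))\<^sup>2) \<le>
      (1 - \<tau>) * (B * ?Z) + r / 56 * ?G - \<theta> * (f x - f xs) - (1 - \<tau>) * (f x - f y)"
  proof -
    have "B * mean (\<lambda>i. (norm2 (?z i - xs))\<^sup>2) \<le>
        B * ((?Z + \<theta> * ?N) / (1 + \<theta>) + (1 / (1 + \<theta>))\<^sup>2 * (2 * \<beta>\<^sup>2 * ?G - 2 * \<beta> * (wd \<bullet> v)))"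
      unfolding wd_def using B0 \<theta>0 by (intro mult_left_mono mean_mirror_step z x xsc v h) auto
    also have "\<dots> = B * ((1 - \<tau>) * (?Z + \<theta> * ?N)
        + (1 - \<tau>)\<^sup>2 * (2 * \<beta>\<^sup>2 * ?G - 2 * \<beta> * (wd \<bullet> v)))"
    proof -
      have "(?Z + \<theta> * ?N) / (1 + \<theta>) = 1 / (1 + \<theta>) * (?Z + \<theta> * ?N)" by simp
      then show ?thesis by (simp only: \<theta>1)
    qed
    also have "\<dots> = (1 - \<tau>) * (B * ?Z) + \<theta> * (\<mu> / 2 * ?N) + \<tau> * \<beta> * ?G - \<tau> * (wd \<bullet> v)"
    proof -
      have 1: "B * (1 - \<tau>) = \<mu> / 2" using \<kappa> by (simp add: B_def divide_simps)
      have 2: "\<mu> * (1 - \<tau>) * \<beta> = \<tau>" using \<kappa> \<mu> by (simp add: \<beta> divide_simps)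
      have "B * ((1 - \<tau>) * (?Z + \<theta> * ?N) + (1 - \<tau>)\<^sup>2 * (2 * \<beta>\<^sup>2 * ?G - 2 * \<beta> * (wd \<bullet> v))) =
          (1 - \<tau>) * (B * ?Z) + \<theta> * (B * (1 - \<tau>) * ?N)
          + 2 * (B * (1 - \<tau>)) * (1 - \<tau>) * \<beta> * (\<beta> * ?G - wd \<bullet> v)"
        by (simp add: power2_eq_square algebra_simps)
      also have "\<dots> = (1 - \<tau>) * (B * ?Z) + \<theta> * (\<mu> / 2 * ?N)
          + (\<mu> * (1 - \<tau>) * \<beta>) * (\<beta> * ?G - wd \<bullet> v)"
        unfolding 1 by simp
      also have "\<dots> = (1 - \<tau>) * (B * ?Z) + \<theta> * (\<mu> / 2 * ?N) + \<tau> * \<beta> * ?G - \<tau> * (wd \<bullet> v)"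
        unfolding 2 by (simp add: right_diff_distrib)
      finally show ?thesis .
    qed
    also have "\<tau> * \<beta> * ?G \<le> r / 56 * ?G"
    proof (rule mult_right_mono)
      have "\<tau> * \<beta> = \<tau>\<^sup>2 / ((1 - \<tau>) * \<mu>)" by (simp add: \<beta> power2_eq_square)
      also have "\<dots> = (r / 64) / (1 - \<tau>)" using \<mu> by (simp add: \<tau>(4) r_def)
      also have "\<dots> \<le> (r / 64) / (7 / 8)"
        using r \<tau> by (intro divide_left_mono) auto
      finally show "\<tau> * \<beta> \<le> r / 56" by simp
    qed (simp add: dual_sq_nonneg)
    finally show ?thesis using cross by (simp add: distrib_left)
  qed

  have memory: "\<tau> * ?H h \<le> dual_sq h / 8"
  proof -
    have "\<tau> * (p j powi (-2) * (h $ j)\<^sup>2) \<le> (h $ j)\<^sup>2 / p j / 8" if j: "j < n" for j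
    proof -
      have "\<tau> * (p j powi (-2) * (h $ j)\<^sup>2) \<le> p j / 8 * (p j powi (-2) * (h $ j)\<^sup>2)"
        using \<tau>(3)[OF j] p_pos[OF j] by (intro mult_right_mono) auto
      also have "\<dots> = (h $ j)\<^sup>2 / p j / 8"
        using p_pos[OF j] by (simp add: power_int_minus power2_eq_square field_simps)
      finally show ?thesis .
    qed
    then show ?thesis
      using h by (auto simp: wnorm_sq_diag_powi dual_sq_def sum_distrib_left sum_divide_distrib intro!: sum_mono)
  qed
  have memory_decay: "r / 8 * (\<tau> * ?H h) \<le> r / 8 * (dual_sq h / 8)"
    using r memory by (intro mult_left_mono) auto
  \<comment> \<open>The coefficients of \<open>r * dual_sq v\<close> are \<open>1/16 + 1/56 + 1/8 \<le> 1/4\<close>, those of \<open>r * dual_sq h\<close> are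
    \<open>1/16 + 1/56 + 1/64 \<le> 1/8\<close>.\<close>
  have noise: "r / 16 * ?G + r / 56 * ?G + r / 8 * (dual_sq v - dual_sq h) + r / 8 * (dual_sq h / 8)
      \<le> r / 4 * dual_sq v"
  proof -
    have "r * dual_sq v \<ge> 0" "r * dual_sq h \<ge> 0"
      using r dual_sq_nonneg by auto
    then show ?thesis by (simp add: field_simps)
  qed
  have "\<tau> * (f x - f xs) \<le> \<theta> * (f x - f xs)"
    using \<theta>\<tau> xs_le by (intro mult_right_mono) auto
  moreover have "(1 - \<tau>) * (f y - f xs) =
      (f x - f xs) - \<tau> * (f x - f xs) - (1 - \<tau>) * (f x - f y)"
    by (simp add: algebra_simps)
  moreover have "r / 8 * (?H h - dual_sq h + dual_sq v) = r / 8 * ?H h + r / 8 * (dual_sq v - dual_sq h)"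
    by (simp add: algebra_simps)
  moreover have "(1 - \<tau>) * \<Upsilon> (y, z, h) = (1 - \<tau>) * (f y - f xs) + (1 - \<tau>) * (B * ?Z)
      + r / 8 * ?H h - r / 8 * (\<tau> * ?H h)"
  proof -
    have "\<Upsilon> (y, z, h) = (f y - f xs) + B * ?Z + r / 8 * ?H h"
      by (simp add: \<Upsilon> lyapunov_def B_def r_def)
    then show ?thesis by (simp only: left_diff_distrib distrib_left) simp
  qed
  ultimately show ?thesis
    using total f_step z_step memory_decay noise by linarith
qed

end

section \<open>The law of the iterates\<close>

lemma asega_update_carrier:
  assumes "t \<in> carrier_vec n \<times> carrier_vec n \<times> carrier_vec n"
  shows "asega_update n f p \<alpha> \<beta> \<tau> \<mu> i t \<in> carrier_vec n \<times> carrier_vec n \<times> carrier_vec n"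
  using assms
  by (auto simp: asega_update_def Let_def
      intro!: minus_carrier_vec mult_mat_vec_carrier[OF diag_powi_carrier])

lemma asega_support:
  assumes "finite (set_pmf P)" "y0 \<in> carrier_vec n" "h0 \<in> carrier_vec n"
  shows "finite (set_pmf (asega n f P \<alpha> \<beta> \<tau> \<mu> y0 h0 k)) \<and>
    set_pmf (asega n f P \<alpha> \<beta> \<tau> \<mu> y0 h0 k) \<subseteq> carrier_vec n \<times> carrier_vec n \<times> carrier_vec n"
proof (induction k)
  case (Suc k)
  have "set_pmf (asega n f P \<alpha> \<beta> \<tau> \<mu> y0 h0 (Suc k)) =
      (\<Union>t\<in>set_pmf (asega n f P \<alpha> \<beta> \<tau> \<mu> y0 h0 k).
        (\<lambda>i. asega_update n f (pmf P) \<alpha> \<beta> \<tau> \<mu> i t) ` set_pmf P)"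
    by (simp add: set_bind_pmf)
  then show ?case
    using Suc assms(1) asega_update_carrier by (simp only: finite_UN finite_imageI UN_subset_iff) blast
qed (use assms in auto)

lemma expectation_bind_contraction:
  fixes V :: "'a \<Rightarrow> real"
  assumes fin: "finite (set_pmf q)" "\<And>s. s \<in> set_pmf q \<Longrightarrow> finite (set_pmf (K s))"
    and contr: "\<And>s. s \<in> set_pmf q \<Longrightarrow> measure_pmf.expectation (K s) V \<le> c * V s"
  shows "measure_pmf.expectation (bind_pmf q K) V \<le> c * measure_pmf.expectation q V"
proof -
  have "measure_pmf.expectation (bind_pmf q K) V =
      (\<Sum>s\<in>set_pmf q. pmf q s * measure_pmf.expectation (K s) V)"
    using fin by (subst pmf_expectation_bind[of "set_pmf q"]) auto
  also have "\<dots> \<le> (\<Sum>s\<in>set_pmf q. pmf q s * (c * V s))"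
    by (intro sum_mono mult_left_mono contr) auto
  also have "\<dots> = c * measure_pmf.expectation q V"
    by (subst integral_measure_pmf[of "set_pmf q"]) (use fin in \<open>auto simp: sum_distrib_left mult_ac\<close>)
  finally show ?thesis .
qed

theorem corollary4p5:
  shows "\<exists>c>0. \<forall>(n::nat) (M::real mat) (f::rvec \<Rightarrow> real) (\<mu>::real) (xs::rvec).
    n \<ge> 1 \<longrightarrow> pos_def_mat n M \<longrightarrow> M_smooth n M f \<longrightarrow> \<mu> > 0 \<longrightarrow> strongly_convex n \<mu> f \<longrightarrow>
    is_minimizer n f xs \<longrightarrow>
    (let P = sqrt_diag_sampling n M in
     \<exists>\<alpha> \<beta> \<tau> a b d :: real.
       \<alpha> > 0 \<and> \<beta> > 0 \<and> 0 < \<tau> \<and> \<tau> < 1 \<and> a > 0 \<and> b > 0 \<and> d > 0 \<and>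
       (let \<Upsilon> = lyapunov n f (pmf P) xs a b d in
        \<tau> \<ge> c * (sqrt \<mu> / sqrt_diag_sum n M) \<and>
        (\<forall>y0\<in>carrier_vec n. \<forall>h0\<in>carrier_vec n. \<forall>k.
          (let law = asega n f P \<alpha> \<beta> \<tau> \<mu> y0 h0 k in
           (\<forall>(y, z, h)\<in>set_pmf law. f y - f xs \<le> \<Upsilon> (y, z, h)) \<and>
           measure_pmf.expectation law \<Upsilon> \<le> (1 - \<tau>) ^ k * \<Upsilon> (y0, y0, h0)))))"
proof (intro exI[of _ "1/8"] conjI allI impI)
  fix n :: nat and M :: "real mat" and f :: "rvec \<Rightarrow> real" and \<mu> :: real and xs :: rvec
  assume n: "n \<ge> 1" and M: "pos_def_mat n M" and f: "M_smooth n M f" and \<mu>: "\<mu> > 0"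
    and sc: "strongly_convex n \<mu> f" and xs: "is_minimizer n f xs"
  define P where "P = sqrt_diag_sampling n M"
  define s where "s = sqrt_diag_sum n M"
  define \<tau> where "\<tau> = sqrt \<mu> / (8 * s)"
  define \<alpha> where "\<alpha> = 1 / (4 * s\<^sup>2)"
  define \<beta> where "\<beta> = \<tau> / ((1 - \<tau>) * \<mu>)"
  define b where "b = \<mu> / (2 * (1 - \<tau>))"
  define d where "d = 1 / (8 * s\<^sup>2)"
  define \<Upsilon> where "\<Upsilon> = lyapunov n f (pmf P) xs 1 b d"
  have diag_pos: "M $$ (i, i) > 0" if "i < n" for i using pos_def_mat_diag_pos[OF M that] .
  have s: "s > 0"
    unfolding s_def sqrt_diag_sum_def using n diag_pos by (intro sum_pos) (auto simp: lessThan_empty_iff)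
  have p: "pmf P i = (if i < n then sqrt (M $$ (i, i)) / s else 0)" for i
    unfolding P_def s_def by (rule pmf_sqrt_diag_sampling[OF M n])
  interpret coordinate_sampling n "pmf P"
  proof
    show "pmf P i > 0" if "i < n" for i using that diag_pos s by (simp add: p)
    have "(\<Sum>i<n. pmf P i) = (\<Sum>i<n. sqrt (M $$ (i, i))) / s"
      by (simp add: p sum_divide_distrib)
    then show "(\<Sum>i<n. pmf P i) = 1" using s by (simp add: s_def sqrt_diag_sum_def)
  qed
  have diag: "M $$ (i, i) = (pmf P i)\<^sup>2 * s\<^sup>2" if "i < n" for i
    using that s diag_pos[OF that] by (simp add: p power_divide)
  have \<tau>p: "\<tau> \<le> pmf P i / 8" if "i < n" for i
  proof -
    have "sqrt \<mu> / (8 * s) \<le> sqrt (M $$ (i, i)) / (8 * s)"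
      using strong_convexity_le_diag[OF M f sc that] s by (intro divide_right_mono) auto
    then show ?thesis using that by (simp add: \<tau>_def p mult.commute)
  qed
  have \<tau>8: "\<tau> \<le> 1 / 8"
    using \<tau>p[of 0] n pmf_le_1[of P 0] by linarith
  have \<tau>0: "\<tau> > 0" using \<mu> s by (simp add: \<tau>_def)
  have \<tau>2: "\<tau>\<^sup>2 = \<mu> / (64 * s\<^sup>2)"
    using \<mu> by (simp add: \<tau>_def power_divide power_mult_distrib)
  have supp: "set_pmf P \<subseteq> {..<n}" by (auto simp: set_pmf_eq p)
  have finP: "finite (set_pmf P)" using supp finite_subset by blast
  have \<kappa>: "1 - \<tau> > 0" using \<tau>8 by simp
  have pos: "\<alpha> > 0" "\<beta> > 0" "b > 0" "d > 0"
    using s \<mu> \<tau>0 \<kappa> by (auto simp: \<alpha>_def \<beta>_def b_def d_def)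
  have step: "measure_pmf.expectation (map_pmf (\<lambda>i. asega_update n f (pmf P) \<alpha> \<beta> \<tau> \<mu> i t) P) \<Upsilon>
      \<le> (1 - \<tau>) * \<Upsilon> t"
    if t: "t \<in> carrier_vec n \<times> carrier_vec n \<times> carrier_vec n" for t
  proof -
    have "measure_pmf.expectation (map_pmf (\<lambda>i. asega_update n f (pmf P) \<alpha> \<beta> \<tau> \<mu> i t) P) \<Upsilon>
        = mean (\<lambda>i. \<Upsilon> (asega_update n f (pmf P) \<alpha> \<beta> \<tau> \<mu> i t))"
      using supp by (simp add: integral_measure_pmf[of "{..<n}"] subset_iff)
    also have "\<dots> \<le> (1 - \<tau>) * \<Upsilon> t"
      using t asega_contraction[OF M diag s f \<mu> sc xs \<tau>0 \<tau>8 \<tau>p \<tau>2 \<alpha>_def \<beta>_def \<Upsilon>_def[unfolded b_def d_def]]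
      by (cases t) auto
    finally show ?thesis .
  qed
  have bound: "f y - f xs \<le> \<Upsilon> (y, z, h)" if "h \<in> carrier_vec n" for y z h
  proof -
    have "wnorm_sq (diag_powi n (pmf P) (-2)) h \<ge> 0"
      using that by (simp add: wnorm_sq_diag_powi sum_nonneg)
    then show ?thesis using pos by (simp add: \<Upsilon>_def lyapunov_def)
  qed
  have main: "(\<forall>(y, z, h)\<in>set_pmf (asega n f P \<alpha> \<beta> \<tau> \<mu> y0 h0 k). f y - f xs \<le> \<Upsilon> (y, z, h)) \<and>
      measure_pmf.expectation (asega n f P \<alpha> \<beta> \<tau> \<mu> y0 h0 k) \<Upsilon> \<le> (1 - \<tau>) ^ k * \<Upsilon> (y0, y0, h0)"
    if y0: "y0 \<in> carrier_vec n" and h0: "h0 \<in> carrier_vec n" for y0 h0 k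
  proof
    let ?law = "asega n f P \<alpha> \<beta> \<tau> \<mu> y0 h0"
    note support = asega_support[OF finP y0 h0, of f \<alpha> \<beta> \<tau> \<mu>]
    show "\<forall>(y, z, h)\<in>set_pmf (?law k). f y - f xs \<le> \<Upsilon> (y, z, h)"
      using support[of k] bound by auto
    show "measure_pmf.expectation (?law k) \<Upsilon> \<le> (1 - \<tau>) ^ k * \<Upsilon> (y0, y0, h0)"
    proof (induction k)
      case (Suc k)
      have "measure_pmf.expectation (?law (Suc k)) \<Upsilon> \<le> (1 - \<tau>) * measure_pmf.expectation (?law k) \<Upsilon>"
        unfolding asega.simps
        by (rule expectation_bind_contraction) (use support[of k] finP step in auto)
      also have "\<dots> \<le> (1 - \<tau>) * ((1 - \<tau>) ^ k * \<Upsilon> (y0, y0, h0))"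
        using Suc \<kappa> by (intro mult_left_mono) auto
      finally show ?case by simp
    qed simp
  qed
  have rate: "\<tau> \<ge> 1 / 8 * (sqrt \<mu> / sqrt_diag_sum n M)"
    by (simp add: \<tau>_def s_def)
  show "let P = sqrt_diag_sampling n M in
     \<exists>\<alpha> \<beta> \<tau> a b d :: real.
       \<alpha> > 0 \<and> \<beta> > 0 \<and> 0 < \<tau> \<and> \<tau> < 1 \<and> a > 0 \<and> b > 0 \<and> d > 0 \<and>
       (let \<Upsilon> = lyapunov n f (pmf P) xs a b d in
        \<tau> \<ge> 1 / 8 * (sqrt \<mu> / sqrt_diag_sum n M) \<and>
        (\<forall>y0\<in>carrier_vec n. \<forall>h0\<in>carrier_vec n. \<forall>k.
          (let law = asega n f P \<alpha> \<beta> \<tau> \<mu> y0 h0 k in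
           (\<forall>(y, z, h)\<in>set_pmf law. f y - f xs \<le> \<Upsilon> (y, z, h)) \<and>
           measure_pmf.expectation law \<Upsilon> \<le> (1 - \<tau>) ^ k * \<Upsilon> (y0, y0, h0))))"
    unfolding Let_def P_def[symmetric]
    apply (rule exI[of _ \<alpha>], rule exI[of _ \<beta>], rule exI[of _ \<tau>], rule exI[of _ 1], rule exI[of _ b],
        rule exI[of _ d])
    using pos \<tau>0 \<kappa> rate main unfolding \<Upsilon>_def by (intro conjI ballI allI) auto
qed simp

end
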